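(* Let $G$ and $H$ be connected graphs. If the Cartesian product $G \,\Box\, H$ is well-dominated, then either $G$ or $H$ is well-dominated (i.e. at least one of $G$, $H$ is well-dominated).
   Context: All graphs are finite and simple. A set $D\subseteq V(G)$ is a dominating set of $G$ if every vertex of $G$ is in $D$ or adjacent to a vertex of $D$; it is minimal if no proper subset of it is dominating. A graph is well-dominated if all of its minimal (with respect to inclusion) dominating sets have the same cardinality. The Cartesian product $G\,\Box\, H$ has vertex set $V(G)\times V(H)$, and $(g_1,h_1)$, $(g_2,h_2)$ are adjacent iff ($g_1=g_2$ and $h_1h_2\in E(H)$) or ($h_1=h_2$ and $g_1g_2\in E(G)$). *)

theory Defs
  imports "Graph_Theory.Graph_Theory"
begin

text \<open>
  Finite simple graphs are modelled by the locale \<^locale>\<open>pair_graph\<close>: a finite vertex set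
  with a symmetric, irreflexive set of arcs, so that an edge \<open>uv\<close> is the pair of arcs
  \<open>(u, v)\<close> and \<open>(v, u)\<close>.
\<close>

definition dominating_set :: "'a pair_pre_digraph \<Rightarrow> 'a set \<Rightarrow> bool" where
  "dominating_set G D \<longleftrightarrow>
     D \<subseteq> pverts G \<and> (\<forall>v\<in>pverts G. v \<in> D \<or> (\<exists>u\<in>D. (v, u) \<in> parcs G))"

definition minimal_dominating_set :: "'a pair_pre_digraph \<Rightarrow> 'a set \<Rightarrow> bool" where
  "minimal_dominating_set G D \<longleftrightarrow>
     dominating_set G D \<and> (\<forall>D'. D' \<subset> D \<longrightarrow> \<not> dominating_set G D')"

definition well_dominated :: "'a pair_pre_digraph \<Rightarrow> bool" where
  "well_dominated G \<longleftrightarrow>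
     (\<forall>D D'. minimal_dominating_set G D \<longrightarrow> minimal_dominating_set G D' \<longrightarrow> card D = card D')"

definition cartesian_product ::
    "'a pair_pre_digraph \<Rightarrow> 'b pair_pre_digraph \<Rightarrow> ('a \<times> 'b) pair_pre_digraph" where
  "cartesian_product G H =
     \<lparr> pverts = pverts G \<times> pverts H,
       parcs = {((g\<^sub>1, h\<^sub>1), (g\<^sub>2, h\<^sub>2)) | g\<^sub>1 h\<^sub>1 g\<^sub>2 h\<^sub>2.
                  (g\<^sub>1 = g\<^sub>2 \<and> g\<^sub>1 \<in> pverts G \<and> (h\<^sub>1, h\<^sub>2) \<in> parcs H) \<or>
                  (h\<^sub>1 = h\<^sub>2 \<and> h\<^sub>1 \<in> pverts H \<and> (g\<^sub>1, g\<^sub>2) \<in> parcs G)} \<rparr>"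

lemma pair_graph_cartesian_product:
  assumes "pair_graph G" and "pair_graph H"
  shows "pair_graph (cartesian_product G H)"
proof -
  interpret G: pair_graph G by fact
  interpret H: pair_graph H by fact
  let ?P = "cartesian_product G H"
  have wf: "parcs ?P \<subseteq> pverts ?P \<times> pverts ?P"
    by (auto simp: cartesian_product_def dest: G.wellformed' H.wellformed')
  have fin: "finite (pverts ?P)"
    by (simp add: cartesian_product_def)
  have "finite (parcs ?P)"
    using finite_subset[OF wf] fin by blast
  moreover have "sym (parcs ?P)"
    using G.sym_arcs H.sym_arcs by (auto simp: cartesian_product_def symmetric_def sym_def)
  moreover have "fst e \<noteq> snd e" if "e \<in> parcs ?P" for e
    using that G.no_loops H.no_loops by (fastforce simp: cartesian_product_def)
  ultimately show ?thesis
    using wf fin by unfold_locales (auto simp: symmetric_def)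
qed

end

(*
  Let n = |G|, m = |H| >= 2, and let c be the common size of the minimal dominating sets of the
  product. By Bollobas and Cockayne G has a minimum dominating set D each of whose vertices has an
  external private neighbour; then D x V(H) is a minimal dominating set, so c = gamma(G) m and,
  symmetrically, c = gamma(H) n. Replacing D x N[h] by V(G) x {h} keeps the set dominating, so
  gamma(G) |N[h]| <= n for every h. Together with m <= gamma(H) max |N[h]| this forces
  n = gamma(G) k and m = gamma(H) k with k = Delta(G) + 1 = Delta(H) + 1, whence c k = n m.

  For proper k-colourings f of G and g of H the set {(x, y). f x = g y} is independent, so it has at
  most c elements. Its k cyclic shifts partition the product, so it has exactly c elements; permuting
  the colours shows that one factor, say H, has only equitable k-colourings. Every maximal
  independent set B of H is a class of such a colouring, hence |B| k = m and B is a perfect code.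
  So H has no two vertices at distance 2, which makes it complete.
*)

theory Submission
  imports Defs "HOL-Number_Theory.Cong" "HOL-Combinatorics.Transposition"
begin

definition independent_set :: "'a pair_pre_digraph \<Rightarrow> 'a set \<Rightarrow> bool" where
  "independent_set G S \<longleftrightarrow> S \<subseteq> pverts G \<and> (\<forall>u\<in>S. \<forall>v\<in>S. (u, v) \<notin> parcs G)"

definition closed_nbhd :: "'a pair_pre_digraph \<Rightarrow> 'a \<Rightarrow> 'a set" where
  "closed_nbhd G v = insert v {u. (v, u) \<in> parcs G}"

text \<open>Colours are the numbers below \<open>k\<close>, so that they can be added modulo
  \<open>k\<close> and exchanged by transpositions. Classes may be empty.\<close>

definition proper_coloring :: "'a pair_pre_digraph \<Rightarrow> nat \<Rightarrow> ('a \<Rightarrow> nat) \<Rightarrow> bool" where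
  "proper_coloring G k f \<longleftrightarrow>
     (\<forall>v\<in>pverts G. f v < k) \<and> (\<forall>u v. (u, v) \<in> parcs G \<longrightarrow> f u \<noteq> f v)"

definition color_count :: "'a pair_pre_digraph \<Rightarrow> ('a \<Rightarrow> nat) \<Rightarrow> nat \<Rightarrow> nat" where
  "color_count G f i = card {v \<in> pverts G. f v = i}"

section \<open>Dominating and independent sets\<close>

text \<open>A private neighbour \<open>p\<close> of \<open>d\<close>, possibly \<open>d\<close>
  itself, is left undominated by \<open>D - {d}\<close> and hence by every subset of it.\<close>

lemma minimal_dominating_setI:
  assumes D: "dominating_set G D"
    and priv: "\<And>d. d \<in> D \<Longrightarrow> \<exists>p\<in>pverts G. p \<notin> D - {d} \<and> (\<forall>u\<in>D - {d}. (p, u) \<notin> parcs G)"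
  shows "minimal_dominating_set G D"
  unfolding minimal_dominating_set_def
proof (intro conjI allI impI notI)
  fix D' assume "D' \<subset> D" and D': "dominating_set G D'"
  then obtain d where d: "d \<in> D" "D' \<subseteq> D - {d}" by blast
  with priv obtain p where "p \<in> pverts G" "p \<notin> D - {d}" "\<forall>u\<in>D - {d}. (p, u) \<notin> parcs G" by blast
  with D' d show False unfolding dominating_set_def by blast
qed (fact D)

lemma exists_minimal_dominating_subset:
  assumes "finite D" "dominating_set G D"
  shows "\<exists>M\<subseteq>D. minimal_dominating_set G M"
  using assms
proof (induction D rule: finite_psubset_induct)
  case (psubset D)
  show ?case
  proof (cases "minimal_dominating_set G D")
    case False
    with psubset.prems obtain D' where "D' \<subset> D" "dominating_set G D'"
      unfolding minimal_dominating_set_def by blast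
    with psubset.IH show ?thesis by (meson order_trans psubset_imp_subset)
  qed blast
qed

context pair_graph
begin

lemma no_self_arc: "(v, v) \<notin> parcs G"
  using pair_no_loops by fastforce

lemma arc_commute: "(u, v) \<in> parcs G \<longleftrightarrow> (v, u) \<in> parcs G"
  using arcs_symmetric by blast

lemma independent_set_insert:
  "independent_set G (insert v S) \<longleftrightarrow>
     v \<in> pverts G \<and> independent_set G S \<and> (\<forall>u\<in>S. (v, u) \<notin> parcs G)"
  unfolding independent_set_def using no_self_arc arc_commute by auto

text \<open>A vertex that a maximal independent set fails to dominate could be added to it.\<close>

lemma exists_maximal_independent:
  assumes "independent_set G S"
  shows "\<exists>M. S \<subseteq> M \<and> independent_set G M \<and> dominating_set G M"
proof -
  have fin: "finite {T. independent_set G T}"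
    by (rule finite_subset[of _ "Pow (pverts G)"]) (auto simp: independent_set_def)
  obtain M where M: "independent_set G M" "S \<subseteq> M"
    and max: "\<And>T. independent_set G T \<Longrightarrow> M \<subseteq> T \<Longrightarrow> M = T"
    using finite_has_maximal2[OF fin, of S] assms by auto
  have "v \<in> M \<or> (\<exists>u\<in>M. (v, u) \<in> parcs G)" if v: "v \<in> pverts G" for v
  proof (rule ccontr)
    assume *: "\<not> ?thesis"
    then have "independent_set G (insert v M)"
      using M v by (simp add: independent_set_insert)
    with max[of "insert v M"] * show False by blast
  qed
  with M show ?thesis unfolding dominating_set_def independent_set_def by blast
qed

text \<open>Each vertex of an independent set is its own private neighbour.\<close>

lemma independent_dominating_is_minimal:
  assumes "independent_set G M" "dominating_set G M"
  shows "minimal_dominating_set G M"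
  using assms by (intro minimal_dominating_setI) (auto simp: independent_set_def)

text \<open>A dominating set shrinks to a minimal one, and an independent set grows to a maximal
  one, which is minimal dominating; both end at the common size.\<close>

lemma well_dominated_bounds:
  assumes wd: "well_dominated G" and M: "minimal_dominating_set G M"
  shows "dominating_set G D \<Longrightarrow> card M \<le> card D"
    and "independent_set G S \<Longrightarrow> card S \<le> card M"
proof -
  assume D: "dominating_set G D"
  then have fin: "finite D" using finite_subset pair_finite_verts unfolding dominating_set_def by blast
  with exists_minimal_dominating_subset[OF _ D] obtain M' where "M' \<subseteq> D" "minimal_dominating_set G M'"
    by blast
  with wd M fin show "card M \<le> card D" unfolding well_dominated_def by (metis card_mono)
next
  assume "independent_set G S"
  then obtain M' where M': "S \<subseteq> M'" "independent_set G M'" "dominating_set G M'"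
    using exists_maximal_independent by blast
  then have "finite M'" using finite_subset pair_finite_verts unfolding dominating_set_def by blast
  with wd M M' independent_dominating_is_minimal show "card S \<le> card M"
    unfolding well_dominated_def by (metis card_mono)
qed

text \<open>Bollobas and Cockayne: among the minimum dominating sets take one that spans the most edges.
  A vertex without an external private neighbour is isolated in it, and exchanging that vertex
  for one of its neighbours would give a minimum dominating set spanning more edges.\<close>

lemma exists_minimum_dominating_external_private:
  assumes noiso: "\<And>v. v \<in> pverts G \<Longrightarrow> \<exists>u. (v, u) \<in> parcs G"
  shows "\<exists>D. dominating_set G D \<and> (\<forall>D'. dominating_set G D' \<longrightarrow> card D \<le> card D') \<and>
    (\<forall>d\<in>D. \<exists>p\<in>pverts G - D. (p, d) \<in> parcs G \<and> (\<forall>u\<in>D. (p, u) \<in> parcs G \<longrightarrow> u = d))"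
proof -
  define minimum where "minimum D \<longleftrightarrow> dominating_set G D \<and>
    (\<forall>D'. dominating_set G D' \<longrightarrow> card D \<le> card D')" for D
  define inner where "inner D = parcs G \<inter> D \<times> D" for D
  have "dominating_set G (pverts G)" by (auto simp: dominating_set_def)
  then have ex: "\<exists>D. minimum D"
    using ex_has_least_nat[of "dominating_set G" _ card] unfolding minimum_def by blast
  \<comment> \<open>An upper bound on the number of inner arcs ensures that a maximum is
    attained.\<close>
  have "card (inner D) < Suc (card (parcs G))" for D
    unfolding inner_def using card_mono[OF pair_finite_arcs] by (simp add: less_Suc_eq_le)
  then obtain D where D: "minimum D" and max: "\<And>D'. minimum D' \<Longrightarrow> card (inner D') \<le> card (inner D)"
    using ex ex_has_greatest_nat[of minimum _ "\<lambda>D. card (inner D)" "Suc (card (parcs G))"] by blast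
  from D have dom: "dominating_set G D" and least: "\<And>D'. dominating_set G D' \<Longrightarrow> card D \<le> card D'"
    by (auto simp: minimum_def)
  have sub: "D \<subseteq> pverts G" using dom by (simp add: dominating_set_def)
  have fin: "finite D" using sub pair_finite_verts finite_subset by blast
  have "\<exists>p\<in>pverts G - D. (p, d) \<in> parcs G \<and> (\<forall>u\<in>D. (p, u) \<in> parcs G \<longrightarrow> u = d)"
    if d: "d \<in> D" for d
  proof (rule ccontr)
    assume none: "\<not> ?thesis"
    have other: "\<exists>u\<in>D - {d}. (p, u) \<in> parcs G" if "p \<in> pverts G - D" for p
      using none that dom unfolding dominating_set_def by blast
    \<comment> \<open>A neighbour in \<open>D\<close> would dominate \<open>d\<close>, and by
      \<open>other\<close> no vertex outside \<open>D\<close> depends on \<open>d\<close>; so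
      \<open>D - {d}\<close> would be a smaller dominating set.\<close>
    have iso: "(d, u) \<notin> parcs G" if "u \<in> D" for u
    proof
      assume du: "(d, u) \<in> parcs G"
      with that have "u \<in> D - {d}" using no_self_arc by auto
      with du other sub have "dominating_set G (D - {d})"
        unfolding dominating_set_def by blast
      from least[OF this] card_Diff1_less[OF fin d] show False by simp
    qed
    obtain u where u: "(d, u) \<in> parcs G" using noiso d sub by blast
    then have uD: "u \<in> pverts G - D" using iso wellformed' by blast
    define D' where "D' = insert u (D - {d})"
    have "dominating_set G D'"
      unfolding dominating_set_def
    proof (intro conjI ballI)
      fix v assume v: "v \<in> pverts G"
      show "v \<in> D' \<or> (\<exists>w\<in>D'. (v, w) \<in> parcs G)"
        using v u other[of v] unfolding D'_def by (cases "v \<in> D") auto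
    qed (use sub uD D'_def in auto)
    moreover have "card D' = card D"
      unfolding D'_def using card_Suc_Diff1[OF fin d] fin uD by (subst card_insert_disjoint) auto
    ultimately have "minimum D'" using D by (auto simp: minimum_def)
    then have le: "card (inner D') \<le> card (inner D)" by (rule max)
    \<comment> \<open>As \<open>u\<close> is not private to \<open>d\<close>, it has another
      neighbour \<open>w\<close> in \<open>D\<close>. The exchange gains the arc from
      \<open>u\<close> to \<open>w\<close> and loses none, since \<open>d\<close> is isolated in
      \<open>D\<close>.\<close>
    obtain w where w: "w \<in> D - {d}" "(u, w) \<in> parcs G" using other[OF uD] by blast
    have "inner D \<subseteq> inner D'"
    proof -
      have "x \<noteq> d \<and> y \<noteq> d" if "(x, y) \<in> inner D" for x y
        using that iso arc_commute unfolding inner_def by blast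
      then show ?thesis unfolding inner_def D'_def by blast
    qed
    moreover have "(u, w) \<in> inner D' - inner D"
      using w uD unfolding inner_def D'_def by blast
    ultimately have "inner D \<subset> inner D'" by blast
    moreover have "finite (inner D')" unfolding inner_def using pair_finite_arcs by blast
    ultimately show False using psubset_card_mono[of "inner D'" "inner D"] le by simp
  qed
  with dom least show ?thesis by blast
qed

section \<open>Covering by closed neighbourhoods\<close>

lemma finite_closed_nbhd: "finite (closed_nbhd G v)"
proof -
  have "{u. (v, u) \<in> parcs G} \<subseteq> pverts G" using wellformed' by blast
  from finite_subset[OF this pair_finite_verts] show ?thesis unfolding closed_nbhd_def by simp
qed

lemma dominating_set_closed_nbhds:
  assumes "dominating_set G D"
  shows "pverts G = (\<Union>d\<in>D. closed_nbhd G d)"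
proof
  show "pverts G \<subseteq> (\<Union>d\<in>D. closed_nbhd G d)"
    using assms arc_commute unfolding dominating_set_def closed_nbhd_def by blast
  show "(\<Union>d\<in>D. closed_nbhd G d) \<subseteq> pverts G"
    using assms wellformed' unfolding dominating_set_def closed_nbhd_def by auto
qed

lemma card_verts_le_dominating:
  assumes "dominating_set G D" and "\<And>v. v \<in> D \<Longrightarrow> card (closed_nbhd G v) \<le> k"
  shows "card (pverts G) \<le> card D * k"
proof -
  have "finite D" using assms(1) finite_subset pair_finite_verts unfolding dominating_set_def by blast
  then have "card (pverts G) \<le> (\<Sum>d\<in>D. card (closed_nbhd G d))"
    unfolding dominating_set_closed_nbhds[OF assms(1)] by (rule card_UN_le)
  also have "\<dots> \<le> of_nat (card D) * k" by (rule sum_bounded_above) (rule assms(2))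
  finally show ?thesis by simp
qed

section \<open>Connectivity\<close>

text \<open>Arcs are symmetric, so every vertex is reachable from \<open>v\<close> by a directed
  walk, and such a walk never leaves \<open>W\<close>.\<close>

lemma connected_closed_eq_verts:
  assumes conn: "Digraph_Component.connected (with_proj G)"
    and v: "v \<in> W" "v \<in> pverts G" "W \<subseteq> pverts G"
    and closed: "\<And>x y. x \<in> W \<Longrightarrow> (x, y) \<in> parcs G \<Longrightarrow> y \<in> W"
  shows "W = pverts G"
proof -
  have "strongly_connected (with_proj G)"
    using sym_arcs conn by (rule symmetric_connected_imp_strongly_connected)
  then have "v \<rightarrow>\<^sup>*\<^bsub>with_proj G\<^esub> u" if "u \<in> pverts G" for u
    using that v by (auto simp: strongly_connected_def)
  moreover have "u \<in> W" if "v \<rightarrow>\<^sup>*\<^bsub>with_proj G\<^esub> u" for u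
    using that by (induction rule: reachable_induct) (use v closed in auto)
  ultimately show ?thesis using v by blast
qed

lemma connected_no_isolated:
  assumes "Digraph_Component.connected (with_proj G)" "card (pverts G) \<noteq> 1" "v \<in> pverts G"
  shows "\<exists>u. (v, u) \<in> parcs G"
proof (rule ccontr)
  assume "\<not> ?thesis"
  then have "{v} = pverts G" using assms by (intro connected_closed_eq_verts) auto
  with assms(2) show False by (metis card_1_singleton_iff One_nat_def)
qed

text \<open>Any single vertex dominates, so the minimal dominating sets are singletons.\<close>

lemma complete_imp_well_dominated:
  assumes complete: "\<And>u v. u \<in> pverts G \<Longrightarrow> v \<in> pverts G \<Longrightarrow> u \<noteq> v \<Longrightarrow> (u, v) \<in> parcs G"
    and ne: "pverts G \<noteq> {}"
  shows "well_dominated G"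
proof -
  have "card D = 1" if D: "minimal_dominating_set G D" for D
  proof -
    have "D \<noteq> {}" "D \<subseteq> pverts G"
      using D ne unfolding minimal_dominating_set_def dominating_set_def by auto
    then obtain d where d: "d \<in> D" "d \<in> pverts G" by blast
    then have "dominating_set G {d}" using complete unfolding dominating_set_def by blast
    with D d have "D = {d}" unfolding minimal_dominating_set_def by blast
    then show ?thesis by simp
  qed
  then show ?thesis unfolding well_dominated_def by metis
qed

section \<open>Proper colourings\<close>

text \<open>Greedy colouring: a vertex has fewer than \<open>k\<close> neighbours, so some colour is
  always free for it.\<close>

lemma extend_partial_coloring:
  assumes deg: "\<And>v. v \<in> pverts G \<Longrightarrow> card (closed_nbhd G v) \<le> k"
    and "W \<subseteq> pverts G" "\<forall>v\<in>W. f v < k"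
    and "\<forall>u\<in>W. \<forall>v\<in>W. (u, v) \<in> parcs G \<longrightarrow> f u \<noteq> f v"
  shows "\<exists>g. proper_coloring G k g \<and> (\<forall>v\<in>W. g v = f v)"
  using assms(2-)
proof (induction "card (pverts G - W)" arbitrary: W f)
  case 0
  then have "W = pverts G" using pair_finite_verts by auto
  with 0 wellformed' show ?case unfolding proper_coloring_def by blast
next
  case (Suc n)
  then obtain v where v: "v \<in> pverts G - W" by (metis card.empty ex_in_conv nat.distinct(1))
  let ?N = "{u. (v, u) \<in> parcs G}"
  have "v \<notin> ?N" using no_self_arc by simp
  moreover have finN: "finite ?N" using finite_closed_nbhd[of v] unfolding closed_nbhd_def by simp
  ultimately have "card ?N < k" using deg[of v] v unfolding closed_nbhd_def by simp
  \<comment> \<open>The new colour also avoids the arbitrary values of \<open>f\<close> at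
    neighbours not yet coloured; the bound on the whole neighbourhood allows this.\<close>
  then have "card (f ` ?N) < card {..<k}" using card_image_le[OF finN, of f] by simp
  then have "\<not> {..<k} \<subseteq> f ` ?N" using card_mono[of "f ` ?N" "{..<k}"] finN by auto
  then obtain a where a: "a < k" "a \<notin> f ` ?N" by blast
  have "n = card (pverts G - insert v W)"
    using Suc.hyps(2) v pair_finite_verts by (metis Diff_insert card_Diff_singleton diff_Suc_1)
  moreover have "\<forall>u\<in>insert v W. \<forall>w\<in>insert v W. (u, w) \<in> parcs G \<longrightarrow> (f(v := a)) u \<noteq> (f(v := a)) w"
    using Suc.prems v a no_self_arc arc_commute[of _ v] by auto
  moreover have "insert v W \<subseteq> pverts G" "\<forall>u\<in>insert v W. (f(v := a)) u < k"
    using Suc.prems v a by auto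
  ultimately obtain g where "proper_coloring G k g" "\<forall>u\<in>insert v W. g u = (f(v := a)) u"
    using Suc.hyps(1) by blast
  with v show ?case by (intro exI[of _ g]) auto
qed

text \<open>Give \<open>B\<close> colour 0 and extend greedily. Every other vertex has a neighbour
  in \<open>B\<close>, so it cannot receive colour 0.\<close>

lemma maximal_independent_is_color_class:
  assumes deg: "\<And>v. v \<in> pverts G \<Longrightarrow> card (closed_nbhd G v) \<le> k" and "0 < k"
    and B: "independent_set G B" "dominating_set G B"
  shows "\<exists>g. proper_coloring G k g \<and> {v \<in> pverts G. g v = 0} = B"
proof -
  obtain g where g: "proper_coloring G k g" "\<forall>v\<in>B. g v = 0"
    using extend_partial_coloring[of k B "\<lambda>_. 0"] assms unfolding independent_set_def by auto
  moreover have "v \<in> B" if "v \<in> pverts G" "g v = 0" for v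
    using that B g unfolding dominating_set_def proper_coloring_def by metis
  ultimately show ?thesis using B unfolding independent_set_def by (intro exI[of _ g]) auto
qed

lemma sum_color_count:
  assumes "proper_coloring G k f"
  shows "(\<Sum>i<k. color_count G f i) = card (pverts G)"
proof -
  have "(\<Sum>i<k. card {v \<in> pverts G. f v = i}) = card (\<Union>i<k. {v \<in> pverts G. f v = i})"
    using pair_finite_verts by (intro card_UN_disjoint[symmetric]) auto
  also have "(\<Union>i<k. {v \<in> pverts G. f v = i}) = pverts G"
    using assms unfolding proper_coloring_def by auto
  finally show ?thesis unfolding color_count_def .
qed

text \<open>Equitability makes every maximal independent set so large that the closed neighbourhoods
  of its vertices, each of size at most \<open>k\<close>, have no room to overlap.\<close>

lemma complete_of_equitable:
  assumes conn: "Digraph_Component.connected (with_proj G)"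
    and deg: "\<And>v. v \<in> pverts G \<Longrightarrow> card (closed_nbhd G v) \<le> k" and "0 < k"
    and equitable: "\<And>f i j. proper_coloring G k f \<Longrightarrow> i < k \<Longrightarrow> j < k \<Longrightarrow>
      color_count G f i = color_count G f j"
    and uv: "u \<in> pverts G" "v \<in> pverts G" "u \<noteq> v"
  shows "(u, v) \<in> parcs G"
proof -
  \<comment> \<open>This excludes vertices at distance 2: otherwise \<open>x\<close> and
    \<open>z\<close> lie in a common maximal independent set, and their closed neighbourhoods share
    \<open>y\<close>.\<close>
  have trans: "(x, z) \<in> parcs G" if "(x, y) \<in> parcs G" "(y, z) \<in> parcs G" "x \<noteq> z" for x y z
  proof (rule ccontr)
    assume xz: "(x, z) \<notin> parcs G"
    then have "independent_set G {x, z}"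
      using that wellformed' by (auto simp: independent_set_insert) (simp add: independent_set_def)
    then obtain B where B: "{x, z} \<subseteq> B" "independent_set G B" "dominating_set G B"
      using exists_maximal_independent by blast
    then have fin: "finite B" using finite_subset pair_finite_verts unfolding dominating_set_def by blast
    obtain g where g: "proper_coloring G k g" "{v \<in> pverts G. g v = 0} = B"
      using maximal_independent_is_color_class[OF deg \<open>0 < k\<close> B(2,3)] by blast
    have "card (pverts G) = (\<Sum>i<k. color_count G g i)" using sum_color_count[OF g(1)] by simp
    also have "\<dots> = (\<Sum>i<k. card B)"
      using equitable[OF g(1) _ \<open>0 < k\<close>] g(2) by (intro sum.cong) (auto simp: color_count_def)
    finally have size: "card (pverts G) = k * card B" by simp
    have xB: "x \<in> B" and xk: "card (closed_nbhd G x) \<le> k"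
      using B deg unfolding dominating_set_def by auto
    have yx: "y \<in> closed_nbhd G x" and yz: "y \<in> closed_nbhd G z"
      using that arc_commute[of y z] unfolding closed_nbhd_def by auto
    have "pverts G = (\<Union>b\<in>B. closed_nbhd G b)" by (rule dominating_set_closed_nbhds[OF B(3)])
    \<comment> \<open>The vertex \<open>y\<close> remains covered through \<open>z\<close>, so it
      may be dropped from the neighbourhood of \<open>x\<close>. The saved vertex makes the count
      strict.\<close>
    also have "\<dots> = (\<Union>b\<in>B - {x}. closed_nbhd G b) \<union> (closed_nbhd G x - {y})"
      using B(1) yz that(3) by auto
    finally have "card (pverts G) \<le> card (\<Union>b\<in>B - {x}. closed_nbhd G b) + card (closed_nbhd G x - {y})"
      by (metis card_Un_le)
    also have "card (\<Union>b\<in>B - {x}. closed_nbhd G b) \<le> (\<Sum>b\<in>B - {x}. card (closed_nbhd G b))"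
      using fin by (intro card_UN_le) auto
    also have "\<dots> \<le> of_nat (card (B - {x})) * k"
      using B deg by (intro sum_bounded_above) (auto simp: dominating_set_def)
    also have "card (closed_nbhd G x - {y}) < k"
      using card_Diff1_less[OF finite_closed_nbhd yx] xk by simp
    finally have "card (pverts G) < Suc (card (B - {x})) * k" by simp
    also have "Suc (card (B - {x})) = card B" using fin xB by (rule card_Suc_Diff1)
    finally show False using size by (simp add: mult.commute)
  qed
  \<comment> \<open>By \<open>trans\<close> this neighbourhood is closed under adjacency, so
    connectedness makes it everything.\<close>
  have "closed_nbhd G u = pverts G"
    using trans wellformed' uv
    by (intro connected_closed_eq_verts[OF conn, of u]) (auto simp: closed_nbhd_def)
  with uv show ?thesis unfolding closed_nbhd_def by auto
qed

end

section \<open>Exchanging two colours\<close>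

lemma color_count_transpose:
  "color_count G (transpose p q \<circ> f) i = color_count G f (transpose p q i)"
  unfolding color_count_def comp_def by (metis transpose_involutory)

lemma proper_coloring_transpose:
  assumes "proper_coloring G k f" "p < k" "q < k"
  shows "proper_coloring G k (transpose p q \<circ> f)"
  unfolding proper_coloring_def
proof (intro conjI ballI allI impI)
  fix v assume "v \<in> pverts G"
  then show "(transpose p q \<circ> f) v < k"
    using assms unfolding proper_coloring_def by (simp add: transpose_def)
next
  fix u v assume "(u, v) \<in> parcs G"
  then have "f u \<noteq> f v" using assms(1) unfolding proper_coloring_def by blast
  then show "(transpose p q \<circ> f) u \<noteq> (transpose p q \<circ> f) v" by (metis comp_apply transpose_involutory)
qed

section \<open>The Cartesian product\<close>

lemma pverts_cartesian_product [simp]: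
  "pverts (cartesian_product G H) = pverts G \<times> pverts H"
  by (simp add: cartesian_product_def)

lemma parcs_cartesian_product_iff [simp]:
  "((a, b), (c, d)) \<in> parcs (cartesian_product G H) \<longleftrightarrow>
     a = c \<and> a \<in> pverts G \<and> (b, d) \<in> parcs H \<or> b = d \<and> b \<in> pverts H \<and> (a, c) \<in> parcs G"
  by (auto simp: cartesian_product_def)

text \<open>Swapping coordinates is an isomorphism between the two products. It lets results about
  one factor be applied to the other.\<close>

lemma dominating_set_product_swap:
  assumes "dominating_set (cartesian_product G H) D"
  shows "dominating_set (cartesian_product H G) (prod.swap ` D)"
  unfolding dominating_set_def
proof (intro conjI ballI)
  show "prod.swap ` D \<subseteq> pverts (cartesian_product H G)"
    using assms unfolding dominating_set_def by auto
next
  fix x assume "x \<in> pverts (cartesian_product H G)"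
  then obtain h g where x: "x = (h, g)" "h \<in> pverts H" "g \<in> pverts G" by auto
  then consider "(g, h) \<in> D"
    | a b where "(a, b) \<in> D" "((g, h), (a, b)) \<in> parcs (cartesian_product G H)"
    using assms unfolding dominating_set_def by fastforce
  then show "x \<in> prod.swap ` D \<or> (\<exists>u\<in>prod.swap ` D. (x, u) \<in> parcs (cartesian_product H G))"
  proof cases
    case 1
    then have "(h, g) \<in> prod.swap ` D" by simp
    with x show ?thesis by simp
  next
    case 2
    then have "(b, a) \<in> prod.swap ` D" "(x, (b, a)) \<in> parcs (cartesian_product H G)"
      using x by auto
    then show ?thesis by blast
  qed
qed

lemma minimal_dominating_set_product_swap:
  assumes "minimal_dominating_set (cartesian_product H G) D"
  shows "minimal_dominating_set (cartesian_product G H) (prod.swap ` D)"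
  unfolding minimal_dominating_set_def
proof (intro conjI allI impI notI)
  show "dominating_set (cartesian_product G H) (prod.swap ` D)"
    using assms by (simp add: dominating_set_product_swap minimal_dominating_set_def)
next
  fix D' assume D': "D' \<subset> prod.swap ` D" "dominating_set (cartesian_product G H) D'"
  then have "dominating_set (cartesian_product H G) (prod.swap ` D')"
    by (intro dominating_set_product_swap)
  moreover have "prod.swap ` D' \<subset> D" using D'(1) by force
  ultimately show False using assms unfolding minimal_dominating_set_def by blast
qed

lemma well_dominated_product_swap:
  assumes "well_dominated (cartesian_product G H)"
  shows "well_dominated (cartesian_product H G)"
  unfolding well_dominated_def
proof (intro allI impI)
  fix D D'
  assume "minimal_dominating_set (cartesian_product H G) D"
    "minimal_dominating_set (cartesian_product H G) D'"
  then have "card (prod.swap ` D) = card (prod.swap ` D')"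
    using assms minimal_dominating_set_product_swap unfolding well_dominated_def by blast
  then show "card D = card D'" by (simp add: card_image)
qed

text \<open>If \<open>p\<close> is an external private neighbour of \<open>d\<close>, then
  \<open>(p, h)\<close> is one of \<open>(d, h)\<close>: as \<open>p\<close> is not in
  \<open>D\<close>, its neighbours in the set all lie in the layer of \<open>h\<close>.\<close>

lemma minimal_dominating_set_product_Times:
  assumes D: "dominating_set G D"
    and priv: "\<forall>d\<in>D. \<exists>p\<in>pverts G - D. (p, d) \<in> parcs G \<and> (\<forall>u\<in>D. (p, u) \<in> parcs G \<longrightarrow> u = d)"
  shows "minimal_dominating_set (cartesian_product G H) (D \<times> pverts H)"
proof (rule minimal_dominating_setI)
  show "dominating_set (cartesian_product G H) (D \<times> pverts H)"
    using D by (fastforce simp: dominating_set_def)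
next
  fix x assume "x \<in> D \<times> pverts H"
  then obtain d h where x: "x = (d, h)" "d \<in> D" "h \<in> pverts H" by blast
  with priv obtain p where p: "p \<in> pverts G - D" "\<And>u. u \<in> D \<Longrightarrow> (p, u) \<in> parcs G \<Longrightarrow> u = d"
    by blast
  have "(p, h) \<notin> D \<times> pverts H - {x}"
    using p by blast
  moreover have "\<forall>u\<in>D \<times> pverts H - {x}. ((p, h), u) \<notin> parcs (cartesian_product G H)"
  proof
    fix u assume u: "u \<in> D \<times> pverts H - {x}"
    obtain a b where ab: "u = (a, b)" by (cases u)
    then have "a \<in> D" "(a, b) \<noteq> (d, h)" using u x by auto
    then show "((p, h), u) \<notin> parcs (cartesian_product G H)" using p ab by auto
  qed
  moreover have "(p, h) \<in> pverts (cartesian_product G H)" using x p by simp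
  ultimately show "\<exists>p\<in>pverts (cartesian_product G H). p \<notin> D \<times> pverts H - {x} \<and>
      (\<forall>u\<in>D \<times> pverts H - {x}. (p, u) \<notin> parcs (cartesian_product G H))"
    by blast
qed

text \<open>Layers over neighbours of \<open>h\<close> are dominated by the full layer over
  \<open>h\<close>; each layer farther away keeps its own copy of \<open>D\<close>.\<close>

lemma dominating_set_product_star:
  assumes "pair_graph H" and D: "dominating_set G D" and h: "h \<in> pverts H"
  shows "dominating_set (cartesian_product G H)
    (pverts G \<times> {h} \<union> D \<times> (pverts H - closed_nbhd H h))"
proof -
  interpret H: pair_graph H by fact
  let ?S = "pverts G \<times> {h} \<union> D \<times> (pverts H - closed_nbhd H h)"
  show ?thesis
    unfolding dominating_set_def
  proof (intro conjI ballI)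
    show "?S \<subseteq> pverts (cartesian_product G H)" using D h unfolding dominating_set_def by auto
  next
    fix x assume "x \<in> pverts (cartesian_product G H)"
    then obtain a b where x: "x = (a, b)" "a \<in> pverts G" "b \<in> pverts H" by auto
    consider "b = h" | "(b, h) \<in> parcs H" | "b \<notin> closed_nbhd H h"
      unfolding closed_nbhd_def using H.arc_commute by auto
    then show "x \<in> ?S \<or> (\<exists>u\<in>?S. (x, u) \<in> parcs (cartesian_product G H))"
    proof cases
      case 2
      then have "(a, h) \<in> ?S" "(x, (a, h)) \<in> parcs (cartesian_product G H)" using x by auto
      then show ?thesis by blast
    next
      case 3
      show ?thesis
      proof (cases "a \<in> D")
        case False
        then obtain d where d: "d \<in> D" "(a, d) \<in> parcs G"
          using D x unfolding dominating_set_def by blast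
        then have "(d, b) \<in> ?S" "(x, (d, b)) \<in> parcs (cartesian_product G H)" using x 3 by auto
        then show ?thesis by blast
      qed (use x 3 in auto)
    qed (use x in auto)
  qed
qed

section \<open>Pairs of colourings and independent sets of the product\<close>

text \<open>Along an edge of the product exactly one of the two colours changes, and distinct
  colours below \<open>k\<close> are incongruent modulo \<open>k\<close>; so the sum
  changes.\<close>

lemma independent_set_product_colorings:
  assumes "pair_graph G" "pair_graph H" "proper_coloring G k f" "proper_coloring H k g"
  shows "independent_set (cartesian_product G H)
    {(x, y). x \<in> pverts G \<and> y \<in> pverts H \<and> (f x + g y) mod k = s}"
proof -
  interpret G: pair_graph G by fact
  interpret H: pair_graph H by fact
  have cancel: "b = b'" if "(a + b) mod k = (a + b') mod k" "b < k" "b' < k" for a b b'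
  proof -
    have "[b = b'] (mod k)" using that(1) by (simp add: cong_def[symmetric] cong_add_lcancel_nat)
    with that(2,3) show ?thesis by (simp add: cong_def)
  qed
  show ?thesis
    unfolding independent_set_def
  proof (intro conjI ballI notI)
    fix x y
    assume x: "x \<in> {(x, y). x \<in> pverts G \<and> y \<in> pverts H \<and> (f x + g y) mod k = s}"
      and y: "y \<in> {(x, y). x \<in> pverts G \<and> y \<in> pverts H \<and> (f x + g y) mod k = s}"
      and xy: "(x, y) \<in> parcs (cartesian_product G H)"
    obtain a b where ab: "x = (a, b)" by (cases x)
    obtain a' b' where ab': "y = (a', b')" by (cases y)
    have lt: "f a < k" "f a' < k" "g b < k" "g b' < k"
      using x y ab ab' assms(3,4) by (auto simp: proper_coloring_def)
    have eq: "(f a + g b) mod k = (f a' + g b') mod k" using x y ab ab' by simp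
    from xy ab ab' consider "a = a'" "(b, b') \<in> parcs H" | "b = b'" "(a, a') \<in> parcs G" by auto
    then show False
    proof cases
      case 1
      with cancel[of "f a" "g b" "g b'"] eq lt have "g b = g b'" by simp
      with 1 assms(4) show False unfolding proper_coloring_def by blast
    next
      case 2
      with cancel[of "g b" "f a" "f a'"] eq lt have "f a = f a'" by (simp add: add.commute)
      with 2 assms(3) show False unfolding proper_coloring_def by blast
    qed
  qed auto
qed

text \<open>Sorting the pairs by their common colour turns agreement into the inner product of the
  two vectors of class sizes.\<close>

lemma card_agreement_eq_sum:
  assumes "finite (pverts G)" "finite (pverts H)" "proper_coloring G k f"
  shows "card {(x, y). x \<in> pverts G \<and> y \<in> pverts H \<and> f x = g y} =
    (\<Sum>i<k. color_count G f i * color_count H g i)"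
proof -
  have "{(x, y). x \<in> pverts G \<and> y \<in> pverts H \<and> f x = g y} =
      (\<Union>i<k. {x \<in> pverts G. f x = i} \<times> {y \<in> pverts H. g y = i})"
    using assms(3) unfolding proper_coloring_def by auto
  moreover have "card (\<Union>i<k. {x \<in> pverts G. f x = i} \<times> {y \<in> pverts H. g y = i}) =
      (\<Sum>i<k. card ({x \<in> pverts G. f x = i} \<times> {y \<in> pverts H. g y = i}))"
    using assms(1,2) by (intro card_UN_disjoint) auto
  ultimately show ?thesis by (simp add: color_count_def card_cartesian_product)
qed

text \<open>The product splits into \<open>k\<close> independent sets of size at most
  \<open>c\<close>, and their sizes add up to \<open>c * k\<close>; so each has size exactly
  \<open>c\<close>. The agreement set is one of them.\<close>

lemma card_agreement_eq:
  assumes "pair_graph G" "pair_graph H" "proper_coloring G k f" "proper_coloring H k g" "0 < k"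
    and bound: "\<And>S. independent_set (cartesian_product G H) S \<Longrightarrow> card S \<le> c"
    and c: "c * k = card (pverts G) * card (pverts H)"
  shows "card {(x, y). x \<in> pverts G \<and> y \<in> pverts H \<and> f x = g y} = c"
proof -
  interpret G: pair_graph G by fact
  interpret H: pair_graph H by fact
  \<comment> \<open>Reversing the colours of \<open>f\<close> turns agreement with \<open>g\<close>
    into a constant sum, \<open>k - 1\<close>.\<close>
  define f' where "f' x = k - 1 - f x" for x
  have f': "proper_coloring G k f'"
    unfolding proper_coloring_def
  proof (intro conjI allI impI ballI)
    fix u v assume uv: "(u, v) \<in> parcs G"
    then have "f u < k" "f v < k" "f u \<noteq> f v"
      using assms(3) G.wellformed' unfolding proper_coloring_def by blast+
    then show "f' u \<noteq> f' v" unfolding f'_def by linarith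
  qed (use assms(5) in \<open>auto simp: f'_def\<close>)
  define S where "S s = {(x, y). x \<in> pverts G \<and> y \<in> pverts H \<and> (f' x + g y) mod k = s}" for s
  have S_le: "card (S s) \<le> c" for s
    unfolding S_def by (intro bound independent_set_product_colorings assms f')
  have fin: "finite (S s)" for s
    by (rule finite_subset[of _ "pverts G \<times> pverts H"]) (auto simp: S_def)
  have "(\<Sum>s<k. card (S s)) = card (\<Union>s<k. S s)"
    by (intro card_UN_disjoint[symmetric]) (use fin in \<open>auto simp: S_def\<close>)
  also have "(\<Union>s<k. S s) = pverts G \<times> pverts H" using assms(5) by (auto simp: S_def)
  finally have total: "(\<Sum>s<k. card (S s)) = (\<Sum>s<k. c)"
    using c by (simp add: card_cartesian_product mult.commute)
  have size: "card (S (k - 1)) = c"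
  proof (rule ccontr)
    assume "card (S (k - 1)) \<noteq> c"
    then have "(\<Sum>s<k. card (S s)) < (\<Sum>s<k. c)"
      using S_le assms(5) by (intro sum_strict_mono_ex1) (auto intro!: bexI[of _ "k - 1"] le_neq_implies_less)
    with total show False by simp
  qed
  \<comment> \<open>The sum is at most \<open>2 * k - 2\<close>, so it is congruent to
    \<open>k - 1\<close> only when it equals \<open>k - 1\<close>.\<close>
  have agree: "(f' x + g y) mod k = k - 1 \<longleftrightarrow> f x = g y" if "x \<in> pverts G" "y \<in> pverts H" for x y
  proof -
    have "f x < k" "g y < k" using that assms(3,4) unfolding proper_coloring_def by auto
    then show ?thesis unfolding f'_def by (auto simp: mod_if)
  qed
  have "S (k - 1) = {(x, y). x \<in> pverts G \<and> y \<in> pverts H \<and> f x = g y}"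
    unfolding S_def using agree by auto
  with size show ?thesis by simp
qed

text \<open>Exchanging \<open>p\<close> and \<open>q\<close> in \<open>f\<close> leaves the inner
  product at \<open>c\<close>. The difference of the two inner products is
  \<open>(a p - a q) * (b p - b q)\<close>, and its first factor is nonzero.\<close>

lemma color_count_exchange:
  assumes "finite (pverts G)" "finite (pverts H)"
    and const: "\<And>f g. proper_coloring G k f \<Longrightarrow> proper_coloring H k g \<Longrightarrow>
      card {(x, y). x \<in> pverts G \<and> y \<in> pverts H \<and> f x = g y} = c"
    and f: "proper_coloring G k f" and g: "proper_coloring H k g"
    and pq: "p < k" "q < k" and ne: "color_count G f p \<noteq> color_count G f q"
  shows "color_count H g p = color_count H g q"
proof -
  have "p \<noteq> q" using ne by auto
  \<comment> \<open>Integers, because the differences of class sizes may be negative.\<close>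
  define a where "a i = int (color_count G f i)" for i
  define b where "b i = int (color_count H g i)" for i
  let ?t = "transpose p q"
  have eq: "(\<Sum>i<k. color_count G f i * color_count H g i) = c"
    using card_agreement_eq_sum[OF assms(1,2) f, of g] const[OF f g] by simp
  have eq': "(\<Sum>i<k. color_count G f (?t i) * color_count H g i) = c"
    using card_agreement_eq_sum[OF assms(1,2) proper_coloring_transpose[OF f pq], of g]
      const[OF proper_coloring_transpose[OF f pq] g] by (simp add: color_count_transpose)
  have "int (\<Sum>i<k. color_count G f i * color_count H g i) - int (\<Sum>i<k. color_count G f (?t i) * color_count H g i) = 0"
    unfolding eq eq' by simp
  then have "(\<Sum>i<k. (a i - a (?t i)) * b i) = 0"
    by (simp add: a_def b_def sum_subtractf left_diff_distrib)
  also have "(\<Sum>i<k. (a i - a (?t i)) * b i) = (\<Sum>i\<in>{p, q}. (a i - a (?t i)) * b i)"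
    using pq by (intro sum.mono_neutral_right) auto
  also have "\<dots> = (a p - a q) * (b p - b q)" using \<open>p \<noteq> q\<close> by (simp add: algebra_simps)
  finally show ?thesis using ne by (simp add: a_def b_def)
qed

text \<open>One unequal pair of classes of \<open>f\<close> forces classes \<open>p\<close> and
  \<open>q\<close> to have equal size in every colouring of \<open>H\<close>. Recolouring
  \<open>g\<close> carries this over to all other colours.\<close>

lemma equitable_factor:
  assumes fin: "finite (pverts G)" "finite (pverts H)"
    and const: "\<And>f g. proper_coloring G k f \<Longrightarrow> proper_coloring H k g \<Longrightarrow>
      card {(x, y). x \<in> pverts G \<and> y \<in> pverts H \<and> f x = g y} = c"
    and f: "proper_coloring G k f" "p < k" "q < k" "color_count G f p \<noteq> color_count G f q"
    and g: "proper_coloring H k g" "i < k" "j < k"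
  shows "color_count H g i = color_count H g j"
proof -
  have pq: "color_count H g' p = color_count H g' q" if "proper_coloring H k g'" for g'
    by (rule color_count_exchange[OF fin const f(1) that f(2,3,4)])
  have "color_count H g r = color_count H g p" if "r < k" for r
  proof (cases "r = p \<or> r = q")
    case False
    have "p \<noteq> q" using f by auto
    \<comment> \<open>After exchanging \<open>q\<close> and \<open>r\<close> in \<open>g\<close>,
      class \<open>p\<close> is unchanged and class \<open>q\<close> is the old class
      \<open>r\<close>.\<close>
    with False pq[OF proper_coloring_transpose[OF g(1) \<open>q < k\<close> that]]
    show ?thesis by (simp add: color_count_transpose)
  qed (use pq[OF g(1)] in auto)
  with g show ?thesis by metis
qed

section \<open>The common size of minimal dominating sets in terms of one factor\<close>

text \<open>Take \<open>D\<close> with external private neighbours, so that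
  \<open>D \<times> pverts H\<close> has the common size. The star-shaped dominating set around
  \<open>h\<close> cannot be smaller, which bounds \<open>closed_nbhd H h\<close>.\<close>

lemma well_dominated_product_domination_number:
  assumes "pair_graph G" "pair_graph H"
    and noiso: "\<And>v. v \<in> pverts G \<Longrightarrow> \<exists>u. (v, u) \<in> parcs G"
    and wd: "well_dominated (cartesian_product G H)"
    and M: "minimal_dominating_set (cartesian_product G H) M"
  shows "\<exists>D. dominating_set G D \<and> card M = card D * card (pverts H) \<and>
    (\<forall>h\<in>pverts H. card D * card (closed_nbhd H h) \<le> card (pverts G))"
proof -
  interpret G: pair_graph G by fact
  interpret H: pair_graph H by fact
  interpret X: pair_graph "cartesian_product G H" by (rule pair_graph_cartesian_product) fact+
  obtain D where D: "dominating_set G D"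
    and priv: "\<forall>d\<in>D. \<exists>p\<in>pverts G - D. (p, d) \<in> parcs G \<and> (\<forall>u\<in>D. (p, u) \<in> parcs G \<longrightarrow> u = d)"
    using G.exists_minimum_dominating_external_private[OF noiso] by blast
  have fin: "finite D" using D finite_subset G.pair_finite_verts unfolding dominating_set_def by blast
  have "card M = card (D \<times> pverts H)"
    using wd M minimal_dominating_set_product_Times[OF D priv] unfolding well_dominated_def by blast
  then have c: "card M = card D * card (pverts H)" by (simp add: card_cartesian_product)
  moreover have "card D * card (closed_nbhd H h) \<le> card (pverts G)" if h: "h \<in> pverts H" for h
  proof -
    let ?N = "closed_nbhd H h"
    have N: "?N \<subseteq> pverts H" using h H.wellformed' unfolding closed_nbhd_def by auto
    have "card M \<le> card (pverts G \<times> {h} \<union> D \<times> (pverts H - ?N))"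
      by (rule X.well_dominated_bounds(1)[OF wd M dominating_set_product_star[OF \<open>pair_graph H\<close> D h]])
    also have "\<dots> \<le> card (pverts G \<times> {h}) + card (D \<times> (pverts H - ?N))" by (rule card_Un_le)
    also have "\<dots> = card (pverts G) + card D * (card (pverts H) - card ?N)"
      using N by (simp add: card_cartesian_product card_Diff_subset H.finite_closed_nbhd)
    finally have "card D * card (pverts H) \<le> card (pverts G) + card D * (card (pverts H) - card ?N)"
      unfolding c .
    moreover have "card ?N \<le> card (pverts H)" using N by (simp add: card_mono)
    then have "card D * card (pverts H) = card D * (card (pverts H) - card ?N) + card D * card ?N"
      by (metis add_mult_distrib2 le_add_diff_inverse2)
    ultimately show ?thesis by linarith
  qed
  ultimately show ?thesis using D by blast
qed

theorem theorem1:
  fixes G :: "'a pair_pre_digraph" and H :: "'b pair_pre_digraph"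
  assumes "pair_graph G" and "pair_graph H"
    and "Digraph_Component.connected (with_proj G)"
    and "Digraph_Component.connected (with_proj H)"
    and "well_dominated (cartesian_product G H)"
  shows "well_dominated G \<or> well_dominated H"
proof -
  interpret G: pair_graph G by fact
  interpret H: pair_graph H by fact
  interpret X: pair_graph "cartesian_product G H" by (rule pair_graph_cartesian_product) fact+
  have neG: "pverts G \<noteq> {}" and neH: "pverts H \<noteq> {}"
    using assms(3,4) unfolding Digraph_Component.connected_def strongly_connected_def by auto
  \<comment> \<open>A one-vertex factor is complete. It is treated apart because external private
    neighbours require a graph without isolated vertices.\<close>
  consider "card (pverts G) = 1" | "card (pverts H) = 1"
    | (large) "card (pverts G) \<noteq> 1" "card (pverts H) \<noteq> 1" by blast
  then show ?thesis
  proof cases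
    case 1
    then have "well_dominated G"
      by (intro G.complete_imp_well_dominated neG) (auto simp: card_1_singleton_iff)
    then show ?thesis ..
  next
    case 2
    then have "well_dominated H"
      by (intro H.complete_imp_well_dominated neH) (auto simp: card_1_singleton_iff)
    then show ?thesis ..
  next
    case large
    let ?n = "card (pverts G)" and ?m = "card (pverts H)"
    obtain M where M: "minimal_dominating_set (cartesian_product G H) M"
      using exists_minimal_dominating_subset[of "pverts (cartesian_product G H)" "cartesian_product G H"]
      by (auto simp: dominating_set_def)
    let ?c = "card M"
    have "minimal_dominating_set (cartesian_product H G) (prod.swap ` M)"
      by (rule minimal_dominating_set_product_swap[OF M])
    moreover have "card (prod.swap ` M) = ?c" by (simp add: card_image)
    ultimately obtain E where E: "dominating_set H E" and cE: "?c = card E * ?n"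
      and degG: "\<And>v. v \<in> pverts G \<Longrightarrow> card E * card (closed_nbhd G v) \<le> ?m"
      using well_dominated_product_domination_number[OF assms(2,1) H.connected_no_isolated
          well_dominated_product_swap[OF assms(5)]] assms(4) large by metis
    obtain D where D: "dominating_set G D" and cD: "?c = card D * ?m"
      and degH: "\<And>v. v \<in> pverts H \<Longrightarrow> card D * card (closed_nbhd H v) \<le> ?n"
      using well_dominated_product_domination_number[OF assms(1,2) G.connected_no_isolated
          assms(5) M] assms(3) large by metis
    have D0: "0 < card D" and E0: "0 < card E"
      using D E neG neH finite_subset[of D "pverts G"] finite_subset[of E "pverts H"]
      unfolding dominating_set_def by (auto simp: card_gt_0_iff)
    \<comment> \<open>This is the maximum degree of \<open>H\<close> plus one; it serves as the
      number of colours for both factors.\<close>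
    define k where "k = Max ((\<lambda>v. card (closed_nbhd H v)) ` pverts H)"
    have kH: "card (closed_nbhd H v) \<le> k" if "v \<in> pverts H" for v
      unfolding k_def using that by (intro Max_ge) auto
    have "k \<in> (\<lambda>v. card (closed_nbhd H v)) ` pverts H"
      unfolding k_def using neH by (intro Max_in) auto
    then obtain w where w: "w \<in> pverts H" "k = card (closed_nbhd H w)" by blast
    have k0: "0 < k"
      using w H.finite_closed_nbhd[of w] by (auto simp: card_gt_0_iff closed_nbhd_def)
    \<comment> \<open>Comparing the two expressions for the common size gives
      \<open>card E * k \<le> ?m\<close>; covering \<open>H\<close> by the neighbourhoods of
      \<open>E\<close> gives the converse.\<close>
    have "card D * (card E * k) = card E * (card D * k)" by simp
    also have "\<dots> \<le> card E * ?n" using degH w by simp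
    also have "\<dots> = card D * ?m" using cE cD by simp
    finally have "card E * k \<le> ?m" using D0 by simp
    moreover have "?m \<le> card E * k"
      using E kH by (intro H.card_verts_le_dominating) (auto simp: dominating_set_def)
    ultimately have m: "?m = card E * k" by simp
    \<comment> \<open>Cancelling \<open>card E\<close> in \<open>degG\<close> carries the degree
      bound of \<open>H\<close> over to \<open>G\<close>.\<close>
    have kG: "card (closed_nbhd G v) \<le> k" if "v \<in> pverts G" for v
      using degG[OF that] E0 unfolding m by simp
    have ck: "?c * k = ?n * ?m" using cE m by simp
    have const: "card {(x, y). x \<in> pverts G \<and> y \<in> pverts H \<and> f x = g y} = ?c"
      if "proper_coloring G k f" "proper_coloring H k g" for f g
      using card_agreement_eq[OF assms(1,2) that k0 _ ck] X.well_dominated_bounds(2)[OF assms(5) M]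
      by blast
    show ?thesis
    \<comment> \<open>Either an inequitable colouring of \<open>G\<close> makes all
      \<open>k\<close>-colourings of \<open>H\<close> equitable, or those of \<open>G\<close> are
      equitable already. The equitable factor is complete.\<close>
    proof (cases "\<exists>f p q. proper_coloring G k f \<and> p < k \<and> q < k \<and> color_count G f p \<noteq> color_count G f q")
      case True
      then obtain f p q where "proper_coloring G k f" "p < k" "q < k"
        "color_count G f p \<noteq> color_count G f q" by blast
      then have "color_count H g i = color_count H g j" if "proper_coloring H k g" "i < k" "j < k" for g i j
        using equitable_factor[OF G.pair_finite_verts H.pair_finite_verts const] that by blast
      then have "well_dominated H"
        using H.complete_of_equitable[OF assms(4) kH k0] by (intro H.complete_imp_well_dominated neH) blast
      then show ?thesis ..
    next
      case False
      then have "well_dominated G"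
        using G.complete_of_equitable[OF assms(3) kG k0] by (intro G.complete_imp_well_dominated neG) blast
      then show ?thesis ..
    qed
  qed
qed

end
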